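(* Let $V$ be a finite-dimensional real Hilbert space, and let $G\leq \operatorname{O}(V)$ be a finite subgroup. Then for generic $(v,w)\in V^2$, the canonical map $G\to \operatorname{Aut}(Gv\cup Gw)$, $g\mapsto g|_{Gv\cup Gw}$, is a group isomorphism. In particular, two generic orbits determine $G$ up to isomorphism; explicitly, one can assign to each finite subgroup $H\leq \operatorname{O}(V)$ a generic subset $K_H\subseteq V^2$ such that whenever $G,H\leq\operatorname{O}(V)$ are finite, $(v,w)\in K_G$, $(v',w')\in K_H$, and $\{Gv,Gw\}=\{Hv',Hw'\}$, it holds that $G\cong H$ as groups.
   Context: $\operatorname{O}(V)$ is the group of linear isometries (orthogonal maps) of $V$. $Gv=\{gv: g\in G\}$ denotes the orbit of $v$. Genericity: a subset of a topological space $X$ is generic if it is open and dense in $X$; a condition holds for generic $x\in X$ if there is a generic subset of $X$ on which the condition holds. Here $V^2$ carries its usual topology. For a subset $S\subseteq V$, $\operatorname{Aut}(S)$ denotes the group of permutations $\sigma\colon S\to S$ for which there exists a linear isometry $M\colon V\to V$ with $M|_S=\sigma$. *)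

theory Defs
  imports "HOL-Analysis.Analysis" "HOL-Algebra.Group_Action" "HOL-Algebra.Bij"
begin

text \<open>The library's linear isometries \<open>orthogonal_transformation\<close> are not required to be
  surjective. In finite dimension surjectivity is automatic (see \<open>group_orthogonal_group\<close>).\<close>

definition orthogonal_group :: "('a::real_inner \<Rightarrow> 'a) monoid" where
  "orthogonal_group = \<lparr>carrier = {f. orthogonal_transformation f}, mult = (\<circ>), one = id\<rparr>"

text \<open>A subgroup of \<open>O(V)\<close> is a set of functions; these give the group it carries and the orbit
  of a vector under its tautological action, \<open>Gv = {g v | g. g \<in> G}\<close>.\<close>

abbreviation as_group :: "('a::real_inner \<Rightarrow> 'a) set \<Rightarrow> ('a \<Rightarrow> 'a) monoid" where
  "as_group G \<equiv> orthogonal_group\<lparr>carrier := G\<rparr>"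

abbreviation orb :: "('a::real_inner \<Rightarrow> 'a) set \<Rightarrow> 'a \<Rightarrow> 'a set" where
  "orb G v \<equiv> orbit (as_group G) (\<lambda>g. g) v"

text \<open>As in \<open>BijGroup\<close>, a permutation of \<open>S\<close> is represented by an extensional function, i.e.\ one
  that is \<open>undefined\<close> outside \<open>S\<close>; hence \<open>restrict M S = \<sigma>\<close> says that \<open>M\<close> and \<open>\<sigma>\<close> agree on \<open>S\<close>.\<close>

definition Aut_group :: "'a::real_inner set \<Rightarrow> ('a \<Rightarrow> 'a) monoid" where
  "Aut_group S =
     (BijGroup S)\<lparr>carrier := {\<sigma> \<in> Bij S. \<exists>M. orthogonal_transformation M \<and> restrict M S = \<sigma>}\<rparr>"

definition generic :: "'a::topological_space set \<Rightarrow> bool" where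
  "generic K \<longleftrightarrow> open K \<and> closure K = UNIV"

definition holds_generically :: "('a::topological_space \<Rightarrow> bool) \<Rightarrow> bool" where
  "holds_generically P \<longleftrightarrow> (\<exists>K. generic K \<and> (\<forall>x\<in>K. P x))"

lemma orb_eq: "orb G v = {g v | g. g \<in> G}"
  by (simp add: orbit_def)

lemma orthogonal_transformation_bij:
  fixes f :: "'a::real_inner \<Rightarrow> 'a"
  assumes fin_dim: "\<exists>B::'a set. finite B \<and> span B = UNIV"
    and f: "orthogonal_transformation f"
  shows "bij f"
proof -
  have lin: "linear f" using f by (simp add: orthogonal_transformation_def)
  have "norm (f x) = norm x" for x using f by (simp add: orthogonal_transformation)
  then have "f x = 0 \<Longrightarrow> x = 0" for x by (metis norm_eq_zero)
  then have inj: "inj f" using lin by (simp add: linear_injective_0)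
  obtain B0 :: "'a set" where B0: "finite B0" "span B0 = UNIV" using fin_dim by blast
  obtain B where B: "B \<subseteq> B0" "independent B" "span B = UNIV"
  proof -
    obtain B where B: "B \<subseteq> B0" "independent B" "B0 \<subseteq> span B"
      using maximal_independent_subset by blast
    have "span B0 \<subseteq> span B" using B(3) by (rule span_minimal) simp
    then show ?thesis using that B(1,2) B0(2) by blast
  qed
  have finB: "finite B" using B(1) B0(1) finite_subset by blast
  have ind: "independent (f ` B)"
    using linear_independent_injective_image[OF lin B(2)] inj_on_subset[OF inj] by simp
  have "x \<in> span (f ` B)" for x
  proof (rule ccontr)
    assume x: "x \<notin> span (f ` B)"
    then have "independent (insert x (f ` B))" using ind by (simp add: independent_insert)
    then have "card (insert x (f ` B)) \<le> card B"
      using independent_span_bound[OF finB] B(3) by blast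
    moreover have "card (insert x (f ` B)) = Suc (card B)"
    proof -
      have "x \<notin> f ` B" using x span_base[of x "f ` B"] by metis
      moreover have "card (f ` B) = card B" by (rule card_image) (rule inj_on_subset[OF inj], simp)
      ultimately show ?thesis using finB by simp
    qed
    ultimately show False by simp
  qed
  then have "span (f ` B) = UNIV" by blast
  then have "surj f" using linear_span_image[OF lin, of B] B(3) by simp
  then show ?thesis using inj by (simp add: bij_def)
qed

lemma orthogonal_transformation_inv:
  fixes f :: "'a::real_inner \<Rightarrow> 'a"
  assumes fin_dim: "\<exists>B::'a set. finite B \<and> span B = UNIV"
    and f: "orthogonal_transformation f"
  shows "orthogonal_transformation (inv_into UNIV f)"
proof -
  have bij: "bij f" using assms by (rule orthogonal_transformation_bij)
  have lin: "linear f" and ip: "\<And>x y. f x \<bullet> f y = x \<bullet> y"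
    using f by (auto simp: orthogonal_transformation_def)
  have s: "f (inv_into UNIV f x) = x" for x using bij by (simp add: bij_is_surj surj_f_inv_f)
  have i: "inv_into UNIV f (f x) = x" for x using bij by (simp add: bij_is_inj)
  have "linear (inv_into UNIV f)"
  proof (rule linearI)
    fix x y
    have "f (inv_into UNIV f x + inv_into UNIV f y) = x + y"
      by (simp only: linear_add[OF lin] s)
    then show "inv_into UNIV f (x + y) = inv_into UNIV f x + inv_into UNIV f y"
      using i by metis
  next
    fix c x
    have "f (c *\<^sub>R inv_into UNIV f x) = c *\<^sub>R x"
      by (simp only: linear_scale[OF lin] s)
    then show "inv_into UNIV f (c *\<^sub>R x) = c *\<^sub>R inv_into UNIV f x"
      using i by metis
  qed
  moreover have "inv_into UNIV f x \<bullet> inv_into UNIV f y = x \<bullet> y" for x y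
    using ip[of "inv_into UNIV f x" "inv_into UNIV f y"] s by simp
  ultimately show ?thesis by (simp add: orthogonal_transformation_def)
qed

lemma group_orthogonal_group:
  assumes fin_dim: "\<exists>B::'a::real_inner set. finite B \<and> span B = UNIV"
  shows "group (orthogonal_group :: ('a \<Rightarrow> 'a) monoid)"
proof (rule groupI)
  fix f :: "'a \<Rightarrow> 'a"
  assume "f \<in> carrier orthogonal_group"
  then have f: "orthogonal_transformation f" by (simp add: orthogonal_group_def)
  have "inv_into UNIV f \<circ> f = id"
    using orthogonal_transformation_bij[OF fin_dim f] by (simp add: bij_is_inj)
  then show "\<exists>g\<in>carrier orthogonal_group. g \<otimes>\<^bsub>orthogonal_group\<^esub> f = \<one>\<^bsub>orthogonal_group\<^esub>"
    using orthogonal_transformation_inv[OF fin_dim f]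
    by (auto simp: orthogonal_group_def)
qed (simp_all add: orthogonal_group_def orthogonal_transformation_compose
      orthogonal_transformation_id[folded id_def] o_assoc)

lemma subgroup_Aut:
  assumes fin_dim: "\<exists>B::'a::real_inner set. finite B \<and> span B = UNIV"
  shows "subgroup (carrier (Aut_group S)) (BijGroup (S::'a set))"
proof (rule group.subgroupI[OF group_BijGroup])
  show "carrier (Aut_group S) \<subseteq> carrier (BijGroup S)"
    by (auto simp: Aut_group_def BijGroup_def)
  have "orthogonal_transformation (\<lambda>x::'a. x)"
    by (rule orthogonal_transformation_id)
  then have "\<exists>M. orthogonal_transformation M \<and> restrict M S = (\<lambda>x\<in>S. x)"
    by (intro exI[of _ "\<lambda>x. x"]) simp
  then have "(\<lambda>x\<in>S. x) \<in> carrier (Aut_group S)"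
    using id_Bij[of S] by (simp add: Aut_group_def)
  then show "carrier (Aut_group S) \<noteq> {}" by blast
next
  fix \<sigma> assume "\<sigma> \<in> carrier (Aut_group S)"
  then obtain M where \<sigma>: "\<sigma> \<in> Bij S" and M: "orthogonal_transformation M" "restrict M S = \<sigma>"
    by (auto simp: Aut_group_def)
  have inv_eq: "inv\<^bsub>BijGroup S\<^esub> \<sigma> = restrict (inv_into S \<sigma>) S"
    using inv_BijGroup[OF \<sigma>] .
  have bij: "bij_betw \<sigma> S S" using \<sigma> by (simp add: Bij_def)
  have injM: "inj M" using orthogonal_transformation_bij[OF fin_dim M(1)] by (rule bij_is_inj)
  have "inv_into UNIV M x = inv_into S \<sigma> x" if x: "x \<in> S" for x
  proof -
    have y: "inv_into S \<sigma> x \<in> S" "\<sigma> (inv_into S \<sigma> x) = x"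
      using bij x by (auto simp: bij_betw_def inv_into_into f_inv_into_f)
    then have "M (inv_into S \<sigma> x) = x" using M(2) by (metis restrict_apply')
    then show ?thesis using injM by (metis inv_f_f)
  qed
  then have "restrict (inv_into UNIV M) S = restrict (inv_into S \<sigma>) S" by (auto simp: restrict_def)
  then show "inv\<^bsub>BijGroup S\<^esub> \<sigma> \<in> carrier (Aut_group S)"
    unfolding inv_eq using restrict_inv_into_Bij[OF \<sigma>] orthogonal_transformation_inv[OF fin_dim M(1)]
    by (auto simp: Aut_group_def)
next
  fix \<sigma> \<tau> assume "\<sigma> \<in> carrier (Aut_group S)" "\<tau> \<in> carrier (Aut_group S)"
  then obtain M N where \<sigma>: "\<sigma> \<in> Bij S" and M: "orthogonal_transformation M" "restrict M S = \<sigma>"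
    and \<tau>: "\<tau> \<in> Bij S" and N: "orthogonal_transformation N" "restrict N S = \<tau>"
    by (auto simp: Aut_group_def)
  have "orthogonal_transformation (M \<circ> N)"
    using M(1) N(1) by (rule orthogonal_transformation_compose)
  moreover have "restrict (M \<circ> N) S = compose S \<sigma> \<tau>"
  proof
    fix x
    have "M (N x) = \<sigma> (\<tau> x)" if "x \<in> S"
    proof -
      have "\<tau> x \<in> S" using Bij_imp_funcset[OF \<tau>] that by (rule funcset_mem)
      moreover have "N x = \<tau> x" using N(2) that by (metis restrict_apply')
      ultimately show ?thesis using M(2) by (metis restrict_apply')
    qed
    then show "restrict (M \<circ> N) S x = compose S \<sigma> \<tau> x"
      by (simp add: compose_def)
  qed
  ultimately show "\<sigma> \<otimes>\<^bsub>BijGroup S\<^esub> \<tau> \<in> carrier (Aut_group S)"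
    using compose_Bij[OF \<sigma> \<tau>] \<sigma> \<tau> by (auto simp: Aut_group_def BijGroup_def)
qed

lemma group_Aut_group:
  assumes "\<exists>B::'a::real_inner set. finite B \<and> span B = UNIV"
  shows "group (Aut_group (S::'a set))"
proof -
  have "(BijGroup S)\<lparr>carrier := carrier (Aut_group S)\<rparr> = Aut_group S"
    by (simp add: Aut_group_def)
  then show ?thesis
    using subgroup.subgroup_is_group[OF subgroup_Aut[OF assms, of S] group_BijGroup] by simp
qed

end

theory Submission
  imports Defs
begin

text \<open>
  Call \<open>(v, w)\<close> a separating pair for \<open>G\<close> if the numbers \<open>g v \<bullet> w\<close> with \<open>g \<in> G\<close> are pairwise
  distinct and, unless \<open>V = 0\<close>, \<open>v\<close> and \<open>w\<close> have different norms. These are finitely many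
  conditions \<open>q (v, w) \<noteq> 0\<close>, each for a continuous quadratic form \<open>q\<close> on \<open>V\<^sup>2\<close> that is not
  identically zero, so separating pairs are generic (\<open>generic_separating_pairs\<close>).

  Let \<open>(v, w)\<close> be separating and let \<open>M\<close> be a linear isometry that maps \<open>Gv \<union> Gw\<close> into itself.
  The norms force \<open>M\<close> to preserve each of the two orbits. If \<open>M (g v) = p v\<close> and
  \<open>M (h w) = r w\<close> with \<open>g, h, p, r \<in> G\<close>, then invariance of the inner product gives
  \<open>r\<^sup>-\<^sup>1p v \<bullet> w = h\<^sup>-\<^sup>1g v \<bullet> w\<close>, hence \<open>r\<^sup>-\<^sup>1p = h\<^sup>-\<^sup>1g\<close>: an inner product
  between the two orbits remembers the relative position of its arguments
  (\<open>separating_pair_cancel\<close>). Taking \<open>h = 1\<close>, and then \<open>g = 1\<close>,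
  shows that \<open>M\<close> acts on both orbits as the single element \<open>r\<^sub>0\<close> with \<open>M w = r\<^sub>0 w\<close> (\<open>isometry_of_two_orbits\<close>). So \<open>G \<rightarrow> Aut(Gv \<union> Gw)\<close> is onto; it is
  injective because \<open>v\<close> alone already has trivial stabiliser.

  The last assertion follows since \<open>Aut(Gv \<union> Gw)\<close> depends only on the union of the two orbits.
\<close>

section \<open>Generic sets\<close>

lemma generic_UNIV: "generic UNIV"
  by (simp add: generic_def)

lemma generic_Int:
  assumes "generic A" "generic B"
  shows "generic (A \<inter> B)"
proof -
  have "closure (A \<inter> B) = closure A"
    using assms by (intro closure_open_Int_superset) (auto simp: generic_def)
  then show ?thesis
    using assms by (auto simp: generic_def)
qed

lemma generic_INT:
  assumes "finite I" "\<And>i. i \<in> I \<Longrightarrow> generic (A i)"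
  shows "generic (\<Inter>i\<in>I. A i)"
  using assms by (induction I rule: finite_induct) (auto simp: generic_UNIV generic_Int)

text \<open>If \<open>q\<close> vanished near \<open>x\<close>, the parallelogram law at \<open>x\<close> with a small multiple of \<open>d\<close> would
  force \<open>q d = 0\<close>.\<close>

lemma generic_quadratic_form_nonzero:
  fixes q :: "'b::real_normed_vector \<Rightarrow> real"
  assumes cont: "continuous_on UNIV q"
    and parallelogram: "\<And>x y. q (x + y) + q (x - y) = 2 * q x + 2 * q y"
    and scale: "\<And>t x. q (t *\<^sub>R x) = t\<^sup>2 * q x"
    and nz: "q d \<noteq> 0"
  shows "generic {x. q x \<noteq> 0}"
proof -
  have "x \<in> closure {x. q x \<noteq> 0}" for x
  proof (rule ccontr)
    assume "x \<notin> closure {x. q x \<noteq> 0}"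
    then obtain e where e: "e > 0" "\<And>y. dist y x < e \<Longrightarrow> q y = 0"
      by (auto simp: closure_approachable)
    define t where "t = e / (2 * (norm d + 1))"
    have pos: "norm d + 1 > 0"
      using norm_ge_zero[of d] by linarith
    have t: "t > 0"
      using e(1) pos by (simp add: t_def)
    have "t * norm d < t * (2 * (norm d + 1))"
      using t pos by (intro mult_strict_left_mono) auto
    also have "\<dots> = e"
      using pos by (simp add: t_def)
    finally have "norm (t *\<^sub>R d) < e"
      using t by simp
    then have "q (x + t *\<^sub>R d) = 0" "q (x - t *\<^sub>R d) = 0" "q x = 0"
      using e by (auto simp: dist_norm)
    then have "t\<^sup>2 * q d = 0"
      using parallelogram[of x "t *\<^sub>R d"] by (simp add: scale)
    then show False
      using t nz by simp
  qed
  moreover have "open {x. q x \<noteq> 0}"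
    using cont by (intro open_Collect_neq) auto
  ultimately show ?thesis
    by (auto simp: generic_def)
qed

section \<open>Separating pairs\<close>

text \<open>In the zero space the two norms always agree, so the norm condition is waived there.\<close>

definition separating_pairs :: "('a::real_inner \<Rightarrow> 'a) set \<Rightarrow> ('a \<times> 'a) set" where
  "separating_pairs G =
     {(v, w). inj_on (\<lambda>g. g v \<bullet> w) G \<and> ((\<forall>x::'a. x = 0) \<or> norm v \<noteq> norm w)}"

lemma generic_inner_neq:
  fixes a b :: "'a::real_inner \<Rightarrow> 'a"
  assumes a: "orthogonal_transformation a" and b: "orthogonal_transformation b" and "a \<noteq> b"
  shows "generic {(v, w). a v \<bullet> w \<noteq> b v \<bullet> w}"
proof -
  let ?q = "\<lambda>z. a (fst z) \<bullet> snd z - b (fst z) \<bullet> snd z"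
  have lin: "linear a" "linear b"
    using a b by (auto simp: orthogonal_transformation_def)
  have bl: "bounded_linear a" "bounded_linear b"
    using a b lin by (auto simp: orthogonal_transformation linear_conv_bounded_linear
        intro!: bounded_linear_intro[of _ 1] linear_add linear_scale)
  obtain x where "a x \<noteq> b x"
    using \<open>a \<noteq> b\<close> by blast
  have "generic {z. ?q z \<noteq> 0}"
  proof (rule generic_quadratic_form_nonzero)
    show "continuous_on UNIV ?q"
      by (intro continuous_intros bounded_linear.continuous_on[OF bl(1)]
          bounded_linear.continuous_on[OF bl(2)])
    show "?q (y + z) + ?q (y - z) = 2 * ?q y + 2 * ?q z" for y z
      by (simp add: linear_add[OF lin(1)] linear_add[OF lin(2)] linear_diff[OF lin(1)]
          linear_diff[OF lin(2)] inner_add_left inner_add_right inner_diff_left inner_diff_right)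
    show "?q (t *\<^sub>R z) = t\<^sup>2 * ?q z" for t z
      by (simp add: linear_scale[OF lin(1)] linear_scale[OF lin(2)] power2_eq_square algebra_simps)
    show "?q (x, a x - b x) \<noteq> 0"
      using \<open>a x \<noteq> b x\<close> by (simp flip: inner_diff_left)
  qed
  moreover have "{z. ?q z \<noteq> 0} = {(v, w). a v \<bullet> w \<noteq> b v \<bullet> w}"
    by auto
  ultimately show ?thesis
    by simp
qed

lemma generic_norm_neq:
  assumes "(u::'a::real_inner) \<noteq> 0"
  shows "generic {(v::'a, w::'a). norm v \<noteq> norm w}"
proof -
  let ?q = "\<lambda>z::'a \<times> 'a. fst z \<bullet> fst z - snd z \<bullet> snd z"
  have "generic {z. ?q z \<noteq> 0}"
  proof (rule generic_quadratic_form_nonzero)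
    show "continuous_on UNIV ?q"
      by (intro continuous_intros)
    show "?q (y + z) + ?q (y - z) = 2 * ?q y + 2 * ?q z" for y z
      by (simp add: inner_add_left inner_add_right inner_diff_left inner_diff_right)
    show "?q (t *\<^sub>R z) = t\<^sup>2 * ?q z" for t z
      by (simp add: power2_eq_square algebra_simps)
    show "?q (u, 0) \<noteq> 0"
      using assms by simp
  qed
  moreover have "{z. ?q z \<noteq> 0} = {(v, w). norm v \<noteq> norm w}"
    by (auto simp: norm_eq)
  ultimately show ?thesis
    by simp
qed

lemma generic_separating_pairs:
  fixes G :: "('a::real_inner \<Rightarrow> 'a) set"
  assumes fin: "finite G" and orth: "\<And>g. g \<in> G \<Longrightarrow> orthogonal_transformation g"
  shows "generic (separating_pairs G)"
proof -
  let ?I = "{(a, b) \<in> G \<times> G. a \<noteq> b}"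
  let ?A = "\<Inter>(a, b)\<in>?I. {(v, w). a v \<bullet> w \<noteq> b v \<bullet> w}"
  let ?N = "{(v::'a, w::'a). (\<forall>x::'a. x = 0) \<or> norm v \<noteq> norm w}"
  have "finite ?I"
    by (rule finite_subset[of _ "G \<times> G"]) (use fin in auto)
  moreover have "generic (case i of (a, b) \<Rightarrow> {(v, w). a v \<bullet> w \<noteq> b v \<bullet> w})"
    if i: "i \<in> ?I" for i
  proof -
    obtain a b where "i = (a, b)" "a \<in> G" "b \<in> G" "a \<noteq> b"
      using i by blast
    then show ?thesis
      using generic_inner_neq[OF orth orth] by simp
  qed
  ultimately have "generic ?A"
    by (rule generic_INT)
  moreover have "?A = {(v, w). inj_on (\<lambda>g. g v \<bullet> w) G}"
    by (auto simp: inj_on_def)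
  ultimately have inj: "generic {(v, w). inj_on (\<lambda>g. g v \<bullet> w) G}"
    by simp
  \<comment> \<open>\<open>Z\<close> stands for triviality of the space: as an assumption, \<open>\<forall>x. x = 0\<close> is a looping rewrite
    rule.\<close>
  have norms: "generic {(v::'a, w::'a). Z \<or> norm v \<noteq> norm w}"
    if "\<not> Z \<Longrightarrow> \<exists>u::'a. u \<noteq> 0" for Z
  proof (cases Z)
    case True
    then show ?thesis
      by (simp add: generic_UNIV)
  next
    case False
    then show ?thesis
      using that generic_norm_neq by auto
  qed
  have "generic ?N"
    by (rule norms) simp
  moreover have "separating_pairs G = {(v, w). inj_on (\<lambda>g. g v \<bullet> w) G} \<inter> ?N"
    unfolding separating_pairs_def
    by (rule Set.set_eqI) (simp only: case_prod_beta mem_Collect_eq Int_iff)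
  ultimately show ?thesis
    using generic_Int[OF inj] by simp
qed

section \<open>Isometries permuting two orbits\<close>

lemma orthogonal_subgroupD:
  fixes G :: "('a::real_inner \<Rightarrow> 'a) set"
  assumes fin_dim: "\<exists>B::'a set. finite B \<and> span B = UNIV"
    and G: "subgroup G orthogonal_group"
  shows "g \<in> G \<Longrightarrow> orthogonal_transformation g"
    and "id \<in> G"
    and "g \<in> G \<Longrightarrow> h \<in> G \<Longrightarrow> g \<circ> h \<in> G"
    and "g \<in> G \<Longrightarrow> \<exists>k\<in>G. k \<circ> g = id \<and> g \<circ> k = id"
proof -
  show "g \<in> G \<Longrightarrow> orthogonal_transformation g"
    using subgroup.subset[OF G] by (auto simp: orthogonal_group_def)
  show "id \<in> G"
    using subgroup.one_closed[OF G] by (simp add: orthogonal_group_def)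
  show "g \<in> G \<Longrightarrow> h \<in> G \<Longrightarrow> g \<circ> h \<in> G"
    using subgroup.m_closed[OF G] by (simp add: orthogonal_group_def)
  assume g: "g \<in> G"
  let ?k = "inv\<^bsub>orthogonal_group\<^esub> g"
  have "g \<in> carrier orthogonal_group"
    using subgroup.subset[OF G] g by blast
  note group.l_inv[OF group_orthogonal_group[OF fin_dim] this]
    group.r_inv[OF group_orthogonal_group[OF fin_dim] this]
  then have "?k \<circ> g = id \<and> g \<circ> ?k = id"
    by (simp add: orthogonal_group_def)
  then show "\<exists>k\<in>G. k \<circ> g = id \<and> g \<circ> k = id"
    using subgroup.m_inv_closed[OF G g] by blast
qed

text \<open>Moving \<open>r\<close> and \<open>h\<close> to the other side of the inner product turns the hypothesis into an
  equality between two of the numbers \<open>f v \<bullet> w\<close>, which a separating pair keeps distinct. Here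
  \<open>r'\<close> and \<open>h'\<close> are the inverses of \<open>r\<close> and \<open>h\<close>.\<close>

lemma separating_pair_cancel:
  assumes fin_dim: "\<exists>B::'a::real_inner set. finite B \<and> span B = UNIV"
    and G: "subgroup G (orthogonal_group :: ('a \<Rightarrow> 'a) monoid)"
    and vw: "(v, w) \<in> separating_pairs G"
    and mem: "p \<in> G" "g \<in> G" "r \<in> G" "h \<in> G" "r' \<in> G" "h' \<in> G"
    and r': "r \<circ> r' = id" and h': "h \<circ> h' = id"
    and eq: "p v \<bullet> r w = g v \<bullet> h w"
  shows "r' \<circ> p = h' \<circ> g"
proof -
  note D = orthogonal_subgroupD[OF fin_dim G]
  have ip: "f x \<bullet> f y = x \<bullet> y" if "f \<in> G" for f x y
    using D(1)[OF that] by (simp add: orthogonal_transformation_def)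
  have "r' (p v) \<bullet> w = r (r' (p v)) \<bullet> r w"
    using ip mem by simp
  also have "\<dots> = h (h' (g v)) \<bullet> h w"
    using eq r' h' by (simp add: fun_eq_iff)
  also have "\<dots> = h' (g v) \<bullet> w"
    using ip mem by simp
  finally have "(r' \<circ> p) v \<bullet> w = (h' \<circ> g) v \<bullet> w"
    by simp
  moreover have "r' \<circ> p \<in> G" "h' \<circ> g \<in> G"
    using D(3) mem by auto
  moreover have "inj_on (\<lambda>f. f v \<bullet> w) G"
    using vw by (simp add: separating_pairs_def)
  ultimately show ?thesis
    by (simp add: inj_on_def)
qed

lemma mem_orb: "g \<in> G \<Longrightarrow> g v \<in> orb G v"
  by (auto simp: orb_eq)

text \<open>Unless the space is zero, the norm is constant on each orbit and differs between them, so
  \<open>M\<close> cannot move a point from one orbit to the other. On \<open>Gw\<close> the base point \<open>w\<close> selects \<open>r\<close>; comparing with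
  \<open>w\<close> determines \<open>M\<close> on \<open>Gv\<close>, and comparing with \<open>v\<close> then determines it on \<open>Gw\<close>.\<close>

lemma isometry_of_two_orbits:
  assumes fin_dim: "\<exists>B::'a::real_inner set. finite B \<and> span B = UNIV"
    and G: "subgroup G (orthogonal_group :: ('a \<Rightarrow> 'a) monoid)"
    and vw: "(v, w) \<in> separating_pairs G"
    and M: "orthogonal_transformation M"
    and maps: "M ` (orb G v \<union> orb G w) \<subseteq> orb G v \<union> orb G w"
  shows "\<exists>r\<in>G. \<forall>x\<in>orb G v \<union> orb G w. M x = r x"
proof -
  note D = orthogonal_subgroupD[OF fin_dim G]
  have ipM: "M x \<bullet> M y = x \<bullet> y" for x y
    using M by (simp add: orthogonal_transformation_def)
  have norms: "norm (M x) = norm x" "g \<in> G \<Longrightarrow> norm (g x) = norm x" for x g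
    using M D(1) by (simp_all add: orthogonal_transformation)
  have in_S: "M (g v) \<in> orb G v \<union> orb G w" "M (g w) \<in> orb G v \<union> orb G w" if "g \<in> G" for g
    using maps mem_orb[OF that, of v] mem_orb[OF that, of w] by blast+
  have norm_orb: "norm x = norm y" if "x \<in> orb G y" for x y
    using that norms(2) by (auto simp: orb_eq)
  have split: "M (g v) \<in> orb G v \<and> M (g w) \<in> orb G w" if g: "g \<in> G" for g
  proof (cases "\<forall>x::'a. x = 0")
    case True
    then have "M (g v) = id v" "M (g w) = id w"
      by metis+
    then show ?thesis
      using mem_orb[OF D(2), of v] mem_orb[OF D(2), of w] by simp
  next
    case False
    then have "norm v \<noteq> norm w"
      using vw unfolding separating_pairs_def by blast
    then have "M (g v) \<notin> orb G w" "M (g w) \<notin> orb G v"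
      using norm_orb norms g by metis+
    then show ?thesis
      using in_S[OF g] by blast
  qed
  have Mv: "\<exists>p\<in>G. M (g v) = p v" and Mw: "\<exists>p\<in>G. M (g w) = p w" if "g \<in> G" for g
    using split[OF that] by (auto simp: orb_eq)
  obtain r where r: "r \<in> G" "M w = r w"
    using Mw[OF D(2)] by auto
  obtain r' where r': "r' \<in> G" "r' \<circ> r = id" "r \<circ> r' = id"
    using D(4)[OF r(1)] by blast
  have on_v: "M (g v) = r (g v)" if g: "g \<in> G" for g
  proof -
    obtain p where p: "p \<in> G" "M (g v) = p v"
      using Mv[OF g] by blast
    have "r' \<circ> p = id \<circ> g"
      by (rule separating_pair_cancel[OF fin_dim G vw p(1) g r(1) D(2) r'(1) D(2) r'(3)])
        (use ipM[of "g v" w] p r in simp_all)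
    then have "r (r' (p v)) = r (g v)"
      by (simp add: fun_eq_iff)
    then show ?thesis
      using p(2) r'(3) by (simp add: fun_eq_iff)
  qed
  have on_w: "M (h w) = r (h w)" if h: "h \<in> G" for h
  proof -
    obtain s where s: "s \<in> G" "M (h w) = s w"
      using Mw[OF h] by blast
    obtain s' where s': "s' \<in> G" "s' \<circ> s = id" "s \<circ> s' = id"
      using D(4)[OF s(1)] by blast
    obtain h' where h': "h' \<in> G" "h' \<circ> h = id" "h \<circ> h' = id"
      using D(4)[OF h] by blast
    have "s' \<circ> r = h' \<circ> id"
      by (rule separating_pair_cancel[OF fin_dim G vw r(1) D(2) s(1) h s'(1) h'(1) s'(3) h'(3)])
        (use ipM[of v "h w"] s on_v[OF D(2)] in simp)
    then have "s (s' (r (h w))) = s (h' (h w))"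
      by (simp add: fun_eq_iff)
    then have "r (h w) = s w"
      using s'(3) h'(2) by (simp add: fun_eq_iff)
    then show ?thesis
      using s(2) by simp
  qed
  show ?thesis
    using r(1) on_v on_w by (auto simp: orb_eq)
qed

lemma subgroup_element_bij_orb:
  assumes fin_dim: "\<exists>B::'a::real_inner set. finite B \<and> span B = UNIV"
    and G: "subgroup G (orthogonal_group :: ('a \<Rightarrow> 'a) monoid)" and g: "g \<in> G"
  shows "bij_betw g (orb G v) (orb G v)"
proof -
  note D = orthogonal_subgroupD[OF fin_dim G]
  obtain k where k: "k \<in> G" "k \<circ> g = id" "g \<circ> k = id"
    using D(4)[OF g] by blast
  have closed: "f x \<in> orb G v" if f: "f \<in> G" and x: "x \<in> orb G v" for f x
  proof -
    obtain h where "h \<in> G" "x = h v"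
      using x by (auto simp: orb_eq)
    then show ?thesis
      using mem_orb[OF D(3)[OF f], of h v] by simp
  qed
  show ?thesis
    by (rule bij_betw_byWitness[where f' = k])
      (use k closed[OF g] closed[OF k(1)] in \<open>auto simp: fun_eq_iff\<close>)
qed

lemma restrict_iso_Aut_group:
  assumes fin_dim: "\<exists>B::'a::real_inner set. finite B \<and> span B = UNIV"
    and G: "subgroup G (orthogonal_group :: ('a \<Rightarrow> 'a) monoid)"
    and vw: "(v, w) \<in> separating_pairs G"
  shows "(\<lambda>g. restrict g (orb G v \<union> orb G w))
           \<in> iso (as_group G) (Aut_group (orb G v \<union> orb G w))"
proof -
  note D = orthogonal_subgroupD[OF fin_dim G]
  let ?S = "orb G v \<union> orb G w"
  let ?res = "\<lambda>g. restrict g ?S"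
  have bij_S: "bij_betw g ?S ?S" if "g \<in> G" for g
  proof -
    have "inj g"
      using orthogonal_transformation_bij[OF fin_dim D(1)[OF that]] by (rule bij_is_inj)
    moreover have "g ` ?S = ?S"
      using subgroup_element_bij_orb[OF fin_dim G that] by (simp add: bij_betw_def image_Un)
    ultimately show ?thesis
      by (auto simp: bij_betw_def intro: inj_on_subset)
  qed
  have in_Bij: "?res g \<in> Bij ?S" if "g \<in> G" for g
    using bij_S[OF that] by (auto simp: Bij_def bij_betw_def inj_on_def)
  have in_Aut: "?res g \<in> carrier (Aut_group ?S)" if "g \<in> G" for g
    using in_Bij[OF that] D(1)[OF that] by (auto simp: Aut_group_def)
  have "?res \<in> hom (as_group G) (Aut_group ?S)"
  proof (rule homI)
    fix g h assume gh: "g \<in> carrier (as_group G)" "h \<in> carrier (as_group G)"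
    then have "h \<in> G"
      by simp
    then have "h x \<in> ?S" if "x \<in> ?S" for x
      using bij_betw_apply[OF bij_S] that by blast
    then have "?res (g \<circ> h) = compose ?S (?res g) (?res h)"
      by (auto simp: compose_def restrict_def fun_eq_iff)
    then show "?res (g \<otimes>\<^bsub>as_group G\<^esub> h) = ?res g \<otimes>\<^bsub>Aut_group ?S\<^esub> ?res h"
      using gh in_Bij by (simp add: Aut_group_def BijGroup_def orthogonal_group_def)
  qed (use in_Aut in simp)
  moreover have "inj_on ?res G"
  proof (rule inj_onI)
    fix a b assume ab: "a \<in> G" "b \<in> G" and eq: "?res a = ?res b"
    have "v \<in> ?S"
      using mem_orb[OF D(2), of v] by simp
    then have "a v = b v"
      using fun_cong[OF eq, of v] by simp
    moreover have "inj_on (\<lambda>g. g v \<bullet> w) G"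
      using vw by (simp add: separating_pairs_def)
    ultimately show "a = b"
      using ab by (simp add: inj_on_def)
  qed
  moreover have "\<sigma> \<in> ?res ` G" if "\<sigma> \<in> carrier (Aut_group ?S)" for \<sigma>
  proof -
    obtain M where \<sigma>: "\<sigma> \<in> Bij ?S" and M: "orthogonal_transformation M" "?res M = \<sigma>"
      using \<open>\<sigma> \<in> carrier (Aut_group ?S)\<close> by (auto simp: Aut_group_def)
    have "M ` ?S = \<sigma> ` ?S"
      unfolding M(2)[symmetric] by (simp only: image_restrict_eq)
    also have "\<dots> = ?S"
      using \<sigma> by (auto simp: Bij_def bij_betw_def)
    finally obtain r where "r \<in> G" "\<forall>x\<in>?S. M x = r x"
      using isometry_of_two_orbits[OF fin_dim G vw M(1)] by blast
    then have "\<sigma> = ?res r"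
      unfolding M(2)[symmetric] by (intro restrict_ext) blast
    then show ?thesis
      using \<open>r \<in> G\<close> by blast
  qed
  ultimately show ?thesis
    using in_Aut by (auto simp: iso_def bij_betw_def)
qed

section \<open>Two generic orbits determine the group\<close>

theorem theorem2p12:
  assumes fin_dim: "\<exists>B :: 'a::real_inner set. finite B \<and> span B = UNIV"
  shows "(\<forall>G :: ('a \<Rightarrow> 'a) set. subgroup G orthogonal_group \<and> finite G \<longrightarrow>
            holds_generically (\<lambda>(v, w).
              (\<lambda>g. restrict g (orb G v \<union> orb G w))
                \<in> iso (as_group G) (Aut_group (orb G v \<union> orb G w))))
       \<and> (\<exists>K :: ('a \<Rightarrow> 'a) set \<Rightarrow> ('a \<times> 'a) set.
            (\<forall>H. subgroup H orthogonal_group \<and> finite H \<longrightarrow> generic (K H)) \<and>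
            (\<forall>G H v w v' w'.
              subgroup G orthogonal_group \<and> finite G \<and>
              subgroup H orthogonal_group \<and> finite H \<and>
              (v, w) \<in> K G \<and> (v', w') \<in> K H \<and>
              {orb G v, orb G w} = {orb H v', orb H w'}
              \<longrightarrow> as_group G \<cong> as_group H))"
proof (intro conjI allI impI)
  fix G :: "('a \<Rightarrow> 'a) set"
  assume G: "subgroup G orthogonal_group \<and> finite G"
  then have "generic (separating_pairs G)"
    using generic_separating_pairs orthogonal_subgroupD(1)[OF fin_dim] by blast
  then show "holds_generically (\<lambda>(v, w). (\<lambda>g. restrict g (orb G v \<union> orb G w))
      \<in> iso (as_group G) (Aut_group (orb G v \<union> orb G w)))"
    unfolding holds_generically_def using restrict_iso_Aut_group[OF fin_dim] G by blast
next
  show "\<exists>K :: ('a \<Rightarrow> 'a) set \<Rightarrow> ('a \<times> 'a) set.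
          (\<forall>H. subgroup H orthogonal_group \<and> finite H \<longrightarrow> generic (K H)) \<and>
          (\<forall>G H v w v' w'.
            subgroup G orthogonal_group \<and> finite G \<and>
            subgroup H orthogonal_group \<and> finite H \<and>
            (v, w) \<in> K G \<and> (v', w') \<in> K H \<and>
            {orb G v, orb G w} = {orb H v', orb H w'}
            \<longrightarrow> as_group G \<cong> as_group H)"
  proof (intro exI[of _ separating_pairs] conjI allI impI; elim conjE)
    fix H :: "('a \<Rightarrow> 'a) set"
    assume "subgroup H orthogonal_group" "finite H"
    then show "generic (separating_pairs H)"
      using generic_separating_pairs orthogonal_subgroupD(1)[OF fin_dim] by blast
  next
    fix G H :: "('a \<Rightarrow> 'a) set" and v w v' w'
    assume G: "subgroup G orthogonal_group" and H: "subgroup H orthogonal_group"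
      and vw: "(v, w) \<in> separating_pairs G" and vw': "(v', w') \<in> separating_pairs H"
      and orbits: "{orb G v, orb G w} = {orb H v', orb H w'}"
    let ?S = "orb G v \<union> orb G w"
    have "?S = \<Union>{orb G v, orb G w}"
      by simp
    also have "\<dots> = orb H v' \<union> orb H w'"
      unfolding orbits by simp
    finally have S: "?S = orb H v' \<union> orb H w'" .
    have G_iso: "as_group G \<cong> Aut_group ?S"
      using restrict_iso_Aut_group[OF fin_dim G vw] by (rule is_isoI)
    have H_iso: "as_group H \<cong> Aut_group ?S"
      unfolding S using restrict_iso_Aut_group[OF fin_dim H vw'] by (rule is_isoI)
    have "group (as_group H)"
      using subgroup.subgroup_is_group[OF H group_orthogonal_group[OF fin_dim]] .
    then have "Aut_group ?S \<cong> as_group H"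
      using H_iso by (rule group.iso_sym)
    with G_iso show "as_group G \<cong> as_group H"
      by (rule iso_trans)
  qed
qed

end
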